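(* Let the observed data follow the linear model $\mathbf{y}=\mathbf{H}\mathbf{x}+\mathbf{n}$, where $\mathbf{y}\in\mathbb{C}^{m\times 1}$ is the data vector, $\mathbf{H}\in\mathbb{C}^{m\times n}$ is a known observation matrix with columns $\mathbf{h}_1,\dots,\mathbf{h}_n$, $\mathbf{x}\in\mathbb{C}^{n\times 1}$ is a parameter vector with mean $E_{\mathbf{x}}[\mathbf{x}]$, mutually independent elements $x_1,\dots,x_n$ and covariance matrix $\mathbf{C}_{\mathbf{x}\mathbf{x}}=\mathrm{diag}\{\sigma_{x_1}^2,\sigma_{x_2}^2,\dots,\sigma_{x_n}^2\}$, and $\mathbf{n}\in\mathbb{C}^{m\times 1}$ is a zero mean noise vector with covariance matrix $\mathbf{C}_{\mathbf{n}\mathbf{n}}$ and independent of $\mathbf{x}$ (the joint PDF of $\mathbf{x}$ and $\mathbf{n}$ is otherwise arbitrary). Assume that $\mathbf{H}\mathbf{C}_{\mathbf{x}\mathbf{x}}\mathbf{H}^H+\mathbf{C}_{\mathbf{n}\mathbf{n}}$ is invertible and that, for every $i$, $\sigma_{x_i}^2>0$ and $\mathbf{h}_i\neq\mathbf{0}$. Consider affine estimators $\hat{\mathbf{x}}=\mathbf{E}\mathbf{y}+\mathbf{c}$ with $\mathbf{E}\in\mathbb{C}^{n\times m}$, $\mathbf{c}\in\mathbb{C}^{n\times 1}$, and let $\hat{x}_i$ be the $i$-th component of $\hat{\mathbf{x}}$. Then the CWCU LMMSE estimator, i.e. the affine estimator that, for each $i=1,\dots,n$, minimizes the Bayesian MSE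 $E_{\mathbf{y},\mathbf{x}}[|\hat{x}_i-x_i|^2]$ under the constraint $E_{\mathbf{y}|x_i}[\hat{x}_i|x_i]=x_i$ (for all possible $x_i$), is given by $$\hat{\mathbf{x}}_{\mathrm{CL}}=E_{\mathbf{x}}[\mathbf{x}]+\mathbf{E}_{\mathrm{CL}}(\mathbf{y}-E_{\mathbf{y}}[\mathbf{y}]),\qquad \mathbf{E}_{\mathrm{CL}}=\mathbf{D}\,\mathbf{C}_{\mathbf{x}\mathbf{x}}\mathbf{H}^H(\mathbf{H}\mathbf{C}_{\mathbf{x}\mathbf{x}}\mathbf{H}^H+\mathbf{C}_{\mathbf{n}\mathbf{n}})^{-1},$$ where $\mathbf{D}$ is the real diagonal $n\times n$ matrix with elements $$[\mathbf{D}]_{i,i}=\frac{1}{\sigma_{x_i}^2\,\mathbf{h}_i^H(\mathbf{H}\mathbf{C}_{\mathbf{x}\mathbf{x}}\mathbf{H}^H+\mathbf{C}_{\mathbf{n}\mathbf{n}})^{-1}\mathbf{h}_i}.$$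
   Context: $(\cdot)^H$ denotes conjugate transpose. For random vectors $\mathbf{u},\mathbf{v}$, $\mathbf{C}_{\mathbf{u}\mathbf{v}}=E[(\mathbf{u}-E[\mathbf{u}])(\mathbf{v}-E[\mathbf{v}])^H]$, and $\sigma_{x_i}^2=E[|x_i-E[x_i]|^2]$ is the variance of $x_i$. The subscript of an expectation operator indicates the distribution over which one averages; $E_{\mathbf{y}|x_i}[\,\cdot\,|x_i]$ is the conditional expectation given $x_i$, and "for all possible $x_i$" means for all values $x_i$ can take under its distribution. CWCU LMMSE stands for "component-wise conditionally unbiased linear minimum mean square error"; "linear" means affine in $\mathbf{y}$. *)

theory Defs
  imports "HOL-Probability.Probability"
begin

definition conj_transpose :: "complex^'n^'m \<Rightarrow> complex^'m^'n" where
  "conj_transpose A = (\<chi> i j. cnj (A $ j $ i))"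

text \<open>The scalar \<open>u\<^sup>H v\<close>.\<close>

definition hdot :: "complex^'m \<Rightarrow> complex^'m \<Rightarrow> complex" where
  "hdot u v = (\<Sum>k\<in>UNIV. cnj (u $ k) * v $ k)"

definition cross_cov ::
    "'a measure \<Rightarrow> ('a \<Rightarrow> complex^'n) \<Rightarrow> ('a \<Rightarrow> complex^'m) \<Rightarrow> complex^'m^'n" where
  "cross_cov M u v =
     (\<chi> i j. \<integral>\<omega>. (u \<omega> - (\<integral>\<omega>'. u \<omega>' \<partial>M)) $ i * cnj ((v \<omega> - (\<integral>\<omega>'. v \<omega>' \<partial>M)) $ j) \<partial>M)"

definition complex_variance :: "'a measure \<Rightarrow> ('a \<Rightarrow> complex) \<Rightarrow> real" where
  "complex_variance M X = (\<integral>\<omega>. (cmod (X \<omega> - (\<integral>\<omega>'. X \<omega>' \<partial>M)))\<^sup>2 \<partial>M)"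

text \<open>
  Independence of the generated sigma-algebras; \<open>prob_space.indep_var\<close> requires both random
  variables to have the same value type.
\<close>

definition indep_rv ::
    "'a measure \<Rightarrow> ('a \<Rightarrow> 'b::topological_space) \<Rightarrow> ('a \<Rightarrow> 'c::topological_space) \<Rightarrow> bool" where
  "indep_rv M u v \<longleftrightarrow>
     prob_space.indep_set M (sets (vimage_algebra (space M) u borel))
                            (sets (vimage_algebra (space M) v borel))"

definition complex_cond_exp ::
    "'a measure \<Rightarrow> 'a measure \<Rightarrow> ('a \<Rightarrow> complex) \<Rightarrow> 'a \<Rightarrow> complex" where
  "complex_cond_exp M F X \<omega> =
     Complex (real_cond_exp M F (\<lambda>\<omega>. Re (X \<omega>)) \<omega>) (real_cond_exp M F (\<lambda>\<omega>. Im (X \<omega>)) \<omega>)"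

definition affine_estimator :: "(complex^'m \<Rightarrow> complex^'n) \<Rightarrow> bool" where
  "affine_estimator g \<longleftrightarrow> (\<exists>(E :: complex^'m^'n) c. g = (\<lambda>z. E *v z + c))"

text \<open>
  Conditioning on \<open>x\<^sub>i\<close> is conditioning on the sigma-algebra generated by \<open>x\<^sub>i\<close>.
  A conditional expectation given \<open>x\<^sub>i\<close> is a function of the value of \<open>x\<^sub>i\<close> that is
  determined only up to null sets of the distribution of \<open>x\<^sub>i\<close>, so ``for all possible
  \<open>x\<^sub>i\<close>'' is an almost-everywhere quantifier.
\<close>

definition cwcu ::
    "'a measure \<Rightarrow> ('a \<Rightarrow> complex^'n) \<Rightarrow> ('a \<Rightarrow> complex^'m) \<Rightarrow> 'n \<Rightarrow>
      (complex^'m \<Rightarrow> complex^'n) \<Rightarrow> bool" where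
  "cwcu M x y i g \<longleftrightarrow>
     (AE \<omega> in M. complex_cond_exp M (vimage_algebra (space M) (\<lambda>\<omega>. x \<omega> $ i) borel)
                   (\<lambda>\<omega>. g (y \<omega>) $ i) \<omega> = x \<omega> $ i)"

definition bayes_mse ::
    "'a measure \<Rightarrow> ('a \<Rightarrow> complex^'n) \<Rightarrow> ('a \<Rightarrow> complex^'m) \<Rightarrow> 'n \<Rightarrow>
      (complex^'m \<Rightarrow> complex^'n) \<Rightarrow> real" where
  "bayes_mse M x y i g = (\<integral>\<omega>. (cmod (g (y \<omega>) $ i - x \<omega> $ i))\<^sup>2 \<partial>M)"

definition is_cwcu_lmmse ::
    "'a measure \<Rightarrow> ('a \<Rightarrow> complex^'n) \<Rightarrow> ('a \<Rightarrow> complex^'m) \<Rightarrow>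
      (complex^'m \<Rightarrow> complex^'n) \<Rightarrow> bool" where
  "is_cwcu_lmmse M x y g \<longleftrightarrow>
     affine_estimator g \<and>
     (\<forall>i. cwcu M x y i g \<and>
          (\<forall>g'. affine_estimator g' \<and> cwcu M x y i g' \<longrightarrow> bayes_mse M x y i g \<le> bayes_mse M x y i g'))"

end

theory Submission
  imports Defs
begin

text \<open>
  Fix a component \<open>i\<close>, let \<open>h\<close> be column \<open>i\<close> of \<open>H\<close>, and write component \<open>i\<close> of an affine estimator
  as \<open>w\<^sup>H z + c\<close>. Since \<open>y = H x + n\<close>, its value on the data is \<open>(w\<^sup>H h) x\<^sub>i\<close> plus a
  constant plus a linear combination of the centered variables \<open>x\<^sub>j - E[x\<^sub>j]\<close> (\<open>j \<noteq> i\<close>) and \<open>n\<^sub>k\<close>,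
  each of which is independent of \<open>x\<^sub>i\<close>. Conditioning on \<open>x\<^sub>i\<close> removes that combination and leaves an
  affine function of \<open>x\<^sub>i\<close>, which is almost surely \<open>x\<^sub>i\<close> exactly if its slope is 1 and its offset 0,
  because \<open>x\<^sub>i\<close> has positive variance. So the probabilistic constraint is equivalent to two
  scalar equations (\<open>cwcu_iff\<close>): \<open>w\<^sup>H h = 1\<close>, and the estimator has the right mean, which
  determines \<open>c\<close> from \<open>w\<close>.

  Under these equations the error is \<open>w\<^sup>H (y - E[y]) - (x\<^sub>i - E[x\<^sub>i])\<close>. The covariance of \<open>y\<close> is \<open>A\<close>
  and that of \<open>y\<close> with \<open>x\<^sub>i\<close> is \<open>\<sigma>\<^sub>i\<^sup>2 h\<close>, whose contribution is constant on the constraint set; the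
  mean square error is therefore \<open>w\<^sup>H A w - \<sigma>\<^sub>i\<^sup>2\<close> (\<open>bayes_mse_eq\<close>). It remains to minimize the
  form \<open>w\<^sup>H A w\<close> subject to \<open>w\<^sup>H h = 1\<close>. An invertible covariance matrix is positive definite
  (\<open>positive_definite_second_moments\<close>), and with \<open>s = A\<^sup>-\<^sup>1 h / (h\<^sup>H A\<^sup>-\<^sup>1 h)\<close> every feasible \<open>w\<close>
  satisfies \<open>w\<^sup>H A w = s\<^sup>H A s + (w - s)\<^sup>H A (w - s)\<close>
  (\<open>constrained_form_decomposition\<close>), so \<open>s\<close> is the unique minimizer. The row \<open>s\<^sup>H\<close> is row \<open>i\<close> of
  the matrix in the theorem: the factor \<open>\<sigma>\<^sub>i\<^sup>2\<close> of \<open>Cxx\<close> cancels against the one in \<open>D\<close>.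
\<close>

section \<open>Hermitian forms on complex vectors\<close>

lemma hdot_add_left: "hdot (u + v) z = hdot u z + hdot v z"
  by (simp add: hdot_def algebra_simps sum.distrib)

lemma hdot_add_right: "hdot u (y + z) = hdot u y + hdot u z"
  by (simp add: hdot_def algebra_simps sum.distrib)

lemma hdot_diff_right: "hdot u (y - z) = hdot u y - hdot u z"
  by (simp add: hdot_def algebra_simps sum_subtractf)

lemma hdot_scale_left: "hdot (c *s u) z = cnj c * hdot u z"
  by (simp add: hdot_def sum_distrib_left algebra_simps)

lemma hdot_scale_right: "hdot u (c *s z) = c * hdot u z"
  by (simp add: hdot_def sum_distrib_left algebra_simps)

lemma cnj_hdot: "cnj (hdot u v) = hdot v u"
  by (simp add: hdot_def mult.commute)

lemma hdot_axis: "hdot (axis k 1) z = z $ k"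
proof -
  have "hdot (axis k 1) z = (\<Sum>l\<in>UNIV. if l = k then z $ l else 0)"
    unfolding hdot_def by (intro sum.cong) (auto simp: axis_def)
  then show ?thesis by simp
qed

text \<open>
  Identities for a matrix acting on a vector can thus be read off from the sesquilinear form.
\<close>

lemma hdot_left_eqI:
  assumes "\<And>u. hdot u v = hdot u w"
  shows "v = w"
  using assms[of "axis _ 1"] by (simp add: hdot_axis vec_eq_iff)

lemma hdot_matrix_vector: "hdot u (H *v v) = (\<Sum>j\<in>UNIV. hdot u (column j H) * v $ j)"
proof -
  have "hdot u (H *v v) = (\<Sum>k\<in>UNIV. \<Sum>j\<in>UNIV. cnj (u $ k) * (H $ k $ j * v $ j))"
    by (simp add: hdot_def matrix_vector_mult_def sum_distrib_left)
  also have "\<dots> = (\<Sum>j\<in>UNIV. \<Sum>k\<in>UNIV. cnj (u $ k) * (H $ k $ j * v $ j))"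
    by (rule sum.swap)
  also have "\<dots> = (\<Sum>j\<in>UNIV. hdot u (column j H) * v $ j)"
    by (simp add: hdot_def column_def sum_distrib_right mult.assoc)
  finally show ?thesis .
qed

lemma conj_transpose_vector_nth: "(conj_transpose H *v z) $ i = hdot (column i H) z"
  by (simp add: conj_transpose_def matrix_vector_mult_def hdot_def column_def)

lemma diagonal_vector_nth: "((\<chi> i j. if i = j then d i else 0) *v v) $ i = d i * v $ i"
  for d :: "'n::finite \<Rightarrow> complex"
  by (simp add: matrix_vector_mult_def if_distrib[where f = "\<lambda>c. c * _"] cong: if_cong)

lemma matrix_vector_nth_hdot: "(E *v z) $ i = hdot (\<chi> k. cnj (E $ i $ k)) z"
  by (simp add: matrix_vector_mult_def hdot_def)

definition positive_definite :: "complex^'m^'m \<Rightarrow> bool" where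
  "positive_definite A \<longleftrightarrow>
     (\<forall>u v. hdot u (A *v v) = hdot (A *v u) v) \<and> (\<forall>w. w \<noteq> 0 \<longrightarrow> 0 < Re (hdot w (A *v w)))"

lemma positive_definite_hermitian:
  "positive_definite A \<Longrightarrow> hdot u (A *v v) = hdot (A *v u) v"
  unfolding positive_definite_def by blast

lemma positive_definite_nonneg: "positive_definite A \<Longrightarrow> 0 \<le> Re (hdot w (A *v w))"
proof (cases "w = 0")
  case True
  then show ?thesis by (simp add: hdot_def)
next
  case False
  moreover assume "positive_definite A"
  ultimately show ?thesis
    unfolding positive_definite_def using less_imp_le by blast
qed

lemma matrix_inv_inverse:
  "invertible A \<Longrightarrow> A ** matrix_inv A = mat 1 \<and> matrix_inv A ** A = mat 1"
  unfolding matrix_inv_def invertible_def by (rule someI_ex)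

lemma invertible_mult_inv_vector: "invertible A \<Longrightarrow> A *v (matrix_inv A *v z) = z"
  for A :: "complex^'m^'m"
  by (simp only: matrix_vector_mul_assoc matrix_inv_inverse matrix_vector_mul_lid)

lemma positive_definite_inverse_hermitian:
  assumes "positive_definite A" "invertible A"
  shows "hdot u (matrix_inv A *v v) = hdot (matrix_inv A *v u) v"
  using positive_definite_hermitian[OF assms(1), of "matrix_inv A *v u" "matrix_inv A *v v"]
  by (simp add: invertible_mult_inv_vector[OF assms(2)])

text \<open>
  With \<open>u = A\<^sup>-\<^sup>1 h\<close> the number \<open>h\<^sup>H A\<^sup>-\<^sup>1 h\<close> is \<open>u\<^sup>H A u\<close>. This justifies dividing by it and makes
  the diagonal entries of \<open>D\<close> real.
\<close>

lemma positive_definite_inverse_form: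
  assumes "positive_definite A" "invertible A" "h \<noteq> 0"
  obtains r where "r > 0" "hdot h (matrix_inv A *v h) = complex_of_real r"
proof
  let ?u = "matrix_inv A *v h"
  have Au: "A *v ?u = h"
    by (rule invertible_mult_inv_vector[OF assms(2)])
  have "?u \<noteq> 0"
    using Au assms(3) by auto
  then have "0 < Re (hdot ?u (A *v ?u))"
    using assms(1) unfolding positive_definite_def by blast
  then show "0 < Re (hdot h ?u)"
    using positive_definite_hermitian[OF assms(1), of ?u ?u] by (simp only: Au)
  have "cnj (hdot h ?u) = hdot h ?u"
    using positive_definite_inverse_hermitian[OF assms(1,2), of h h] by (simp add: cnj_hdot)
  then show "hdot h ?u = complex_of_real (Re (hdot h ?u))"
    by (simp add: complex_eq_iff)
qed

text \<open>
  The Lagrange condition for minimizing \<open>w\<^sup>H A w\<close> subject to \<open>w\<^sup>H h = 1\<close> is \<open>A w = \<lambda> h\<close>; the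
  constraint then fixes the multiplier as \<open>\<lambda> = 1 / (h\<^sup>H A\<^sup>-\<^sup>1 h)\<close>.
\<close>

definition constrained_minimizer :: "complex^'m^'m \<Rightarrow> complex^'m \<Rightarrow> complex^'m" where
  "constrained_minimizer A h = (1 / hdot h (matrix_inv A *v h)) *s (matrix_inv A *v h)"

lemma constrained_minimizer_feasible:
  assumes "positive_definite A" "invertible A" "h \<noteq> 0"
  shows "hdot (constrained_minimizer A h) h = 1"
proof -
  obtain r where "r > 0" "hdot h (matrix_inv A *v h) = complex_of_real r"
    using positive_definite_inverse_form[OF assms] by blast
  moreover have "hdot (matrix_inv A *v h) h = hdot h (matrix_inv A *v h)"
    using positive_definite_inverse_hermitian[OF assms(1,2), of h h] by simp
  ultimately show ?thesis
    by (simp add: constrained_minimizer_def hdot_scale_left)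
qed

lemma constrained_minimizer_image:
  assumes "invertible A"
  shows "A *v constrained_minimizer A h = (1 / hdot h (matrix_inv A *v h)) *s h"
  by (simp add: constrained_minimizer_def vector_scalar_commute invertible_mult_inv_vector[OF assms])

text \<open>
  Two feasible vectors differ by some \<open>d\<close> with \<open>d\<^sup>H h = 0\<close>, and such a \<open>d\<close> is orthogonal to the
  minimizer in the inner product of \<open>A\<close>, so this is the theorem of Pythagoras.
\<close>

lemma constrained_form_decomposition:
  assumes "positive_definite A" "invertible A" "h \<noteq> 0" "hdot w h = 1"
  defines "s \<equiv> constrained_minimizer A h"
  shows "hdot w (A *v w) = hdot s (A *v s) + hdot (w - s) (A *v (w - s))"
proof -
  define d where "d = w - s"
  have w: "w = s + d" by (simp add: d_def)
  have "hdot s h = 1"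
    unfolding s_def by (rule constrained_minimizer_feasible[OF assms(1-3)])
  then have "hdot d h = 0"
    using assms(4) w by (simp add: hdot_add_left)
  \<comment> \<open>The image of the minimizer is a multiple of \<open>h\<close>, so the mixed terms vanish.\<close>
  then have ds: "hdot d (A *v s) = 0"
    unfolding s_def constrained_minimizer_image[OF assms(2)] by (simp add: hdot_scale_right)
  have sd: "hdot s (A *v d) = 0"
    using ds positive_definite_hermitian[OF assms(1), of s d] cnj_hdot[of d "A *v s"] by simp
  show ?thesis
    unfolding d_def[symmetric]
    by (simp add: w matrix_vector_right_distrib hdot_add_left hdot_add_right ds sd)
qed

lemma constrained_form_minimum:
  assumes "positive_definite A" "invertible A" "h \<noteq> 0" "hdot w h = 1"
  defines "s \<equiv> constrained_minimizer A h"
  shows "Re (hdot s (A *v s)) \<le> Re (hdot w (A *v w))"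
    and "Re (hdot w (A *v w)) \<le> Re (hdot s (A *v s)) \<Longrightarrow> w = s"
proof -
  have eq: "Re (hdot w (A *v w)) = Re (hdot s (A *v s)) + Re (hdot (w - s) (A *v (w - s)))"
    using constrained_form_decomposition[OF assms(1-4)] by (simp add: s_def)
  then show "Re (hdot s (A *v s)) \<le> Re (hdot w (A *v w))"
    using positive_definite_nonneg[OF assms(1), of "w - s"] by linarith
  assume "Re (hdot w (A *v w)) \<le> Re (hdot s (A *v s))"
  then have "\<not> 0 < Re (hdot (w - s) (A *v (w - s)))"
    using eq by linarith
  then have "w - s = 0"
    using assms(1) unfolding positive_definite_def by blast
  then show "w = s" by simp
qed

section \<open>Second moments of complex random variables\<close>

definition square_integrable :: "'a measure \<Rightarrow> ('a \<Rightarrow> complex) \<Rightarrow> bool" where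
  "square_integrable M f \<longleftrightarrow> f \<in> borel_measurable M \<and> integrable M (\<lambda>\<omega>. (cmod (f \<omega>))\<^sup>2)"

text \<open>
  The inner product of \<open>L\<^sup>2\<close>. It is linear in the first and conjugate linear in the second
  argument, opposite to \<open>hdot\<close>; this matches the convention of \<open>cross_cov\<close>.
\<close>

definition cross_moment :: "'a measure \<Rightarrow> ('a \<Rightarrow> complex) \<Rightarrow> ('a \<Rightarrow> complex) \<Rightarrow> complex" where
  "cross_moment M f g = (\<integral>\<omega>. f \<omega> * cnj (g \<omega>) \<partial>M)"

lemma square_integrable_measurable: "square_integrable M f \<Longrightarrow> f \<in> borel_measurable M"
  by (simp add: square_integrable_def)

lemma square_integrable_mult_cnj:
  assumes "square_integrable M f" "square_integrable M g"
  shows "integrable M (\<lambda>\<omega>. f \<omega> * cnj (g \<omega>))"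
proof (rule Bochner_Integration.integrable_bound)
  show "integrable M (\<lambda>\<omega>. (cmod (f \<omega>))\<^sup>2 + (cmod (g \<omega>))\<^sup>2)"
    using assms by (simp add: square_integrable_def)
  show "(\<lambda>\<omega>. f \<omega> * cnj (g \<omega>)) \<in> borel_measurable M"
  proof (rule borel_measurable_times)
    show "f \<in> borel_measurable M"
      using assms(1) by (rule square_integrable_measurable)
    have "cnj \<in> borel_measurable borel"
      by (intro borel_measurable_continuous_onI continuous_on_cnj continuous_on_id)
    with square_integrable_measurable[OF assms(2)]
    show "(\<lambda>\<omega>. cnj (g \<omega>)) \<in> borel_measurable M"
      by (rule measurable_compose)
  qed
  have "a * b \<le> a\<^sup>2 + b\<^sup>2" for a b :: real
    using sum_squares_bound[of a b] zero_le_power2[of a] zero_le_power2[of b]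
      zero_le_power2[of "a + b"] by (simp add: power2_eq_square algebra_simps)
  then show "AE \<omega> in M. norm (f \<omega> * cnj (g \<omega>)) \<le> norm ((cmod (f \<omega>))\<^sup>2 + (cmod (g \<omega>))\<^sup>2)"
    by (simp add: norm_mult)
qed

lemma square_integrable_add:
  assumes "square_integrable M f" "square_integrable M g"
  shows "square_integrable M (\<lambda>\<omega>. f \<omega> + g \<omega>)"
  unfolding square_integrable_def
proof
  show [measurable]: "(\<lambda>\<omega>. f \<omega> + g \<omega>) \<in> borel_measurable M"
    using assms[THEN square_integrable_measurable] by measurable
  have bound: "(cmod (a + b))\<^sup>2 \<le> 2 * (cmod a)\<^sup>2 + 2 * (cmod b)\<^sup>2" for a b :: complex
  proof -
    have "(cmod (a + b))\<^sup>2 \<le> (cmod a + cmod b)\<^sup>2"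
      by (intro power_mono norm_triangle_ineq) auto
    also have "\<dots> \<le> 2 * (cmod a)\<^sup>2 + 2 * (cmod b)\<^sup>2"
      using sum_squares_bound[of "cmod a" "cmod b"] by (simp add: power2_sum)
    finally show ?thesis .
  qed
  show "integrable M (\<lambda>\<omega>. (cmod (f \<omega> + g \<omega>))\<^sup>2)"
  proof (rule Bochner_Integration.integrable_bound)
    show "integrable M (\<lambda>\<omega>. 2 * (cmod (f \<omega>))\<^sup>2 + 2 * (cmod (g \<omega>))\<^sup>2)"
      using assms by (simp add: square_integrable_def)
  qed (use bound in auto)
qed

lemma square_integrable_scale:
  "square_integrable M f \<Longrightarrow> square_integrable M (\<lambda>\<omega>. c * f \<omega>)"
  unfolding square_integrable_def by (auto simp: norm_mult power_mult_distrib)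

lemma square_integrable_diff:
  assumes "square_integrable M f" "square_integrable M g"
  shows "square_integrable M (\<lambda>\<omega>. f \<omega> - g \<omega>)"
  using square_integrable_add[OF assms(1) square_integrable_scale[OF assms(2), of "-1"]] by simp

lemma square_integrable_sum:
  "(\<And>j. j \<in> J \<Longrightarrow> square_integrable M (f j)) \<Longrightarrow> square_integrable M (\<lambda>\<omega>. \<Sum>j\<in>J. f j \<omega>)"
proof (induction J rule: infinite_finite_induct)
  case (insert j J)
  then show ?case by (simp add: square_integrable_add)
qed (simp_all add: square_integrable_def)

lemma square_integrable_hdot:
  assumes "\<And>k. square_integrable M (\<lambda>\<omega>. Y \<omega> $ k)"
  shows "square_integrable M (\<lambda>\<omega>. hdot w (Y \<omega>))"
  unfolding hdot_def by (intro square_integrable_sum square_integrable_scale assms)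

lemma (in finite_measure) square_integrable_const: "square_integrable M (\<lambda>_. c)"
  by (simp add: square_integrable_def)

lemma (in finite_measure) square_integrable_integrable:
  assumes "square_integrable M f"
  shows "integrable M f"
  using square_integrable_mult_cnj[OF assms square_integrable_const[of 1]] by simp

lemma cross_moment_cnj: "cnj (cross_moment M f g) = cross_moment M g f"
  unfolding cross_moment_def
  using Bochner_Integration.integral_cnj[of M "\<lambda>\<omega>. f \<omega> * cnj (g \<omega>)"]
  by (simp del: Bochner_Integration.integral_cnj add: mult.commute)

lemma cross_moment_add_left:
  assumes "square_integrable M f" "square_integrable M f'" "square_integrable M g"
  shows "cross_moment M (\<lambda>\<omega>. f \<omega> + f' \<omega>) g = cross_moment M f g + cross_moment M f' g"
  unfolding cross_moment_def
  using square_integrable_mult_cnj[OF assms(1,3)] square_integrable_mult_cnj[OF assms(2,3)]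
  by (simp add: distrib_right)

lemma cross_moment_scale_left: "cross_moment M (\<lambda>\<omega>. c * f \<omega>) g = c * cross_moment M f g"
  unfolding cross_moment_def by (simp add: mult.assoc)

lemma cross_moment_sum_left:
  assumes "\<And>j. j \<in> J \<Longrightarrow> square_integrable M (f j)" "square_integrable M g"
  shows "cross_moment M (\<lambda>\<omega>. \<Sum>j\<in>J. f j \<omega>) g = (\<Sum>j\<in>J. cross_moment M (f j) g)"
  unfolding cross_moment_def sum_distrib_right
  using assms by (intro Bochner_Integration.integral_sum square_integrable_mult_cnj)

lemma cross_moment_add_right:
  assumes "square_integrable M f" "square_integrable M g" "square_integrable M g'"
  shows "cross_moment M f (\<lambda>\<omega>. g \<omega> + g' \<omega>) = cross_moment M f g + cross_moment M f g'"
proof -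
  have "cross_moment M f (\<lambda>\<omega>. g \<omega> + g' \<omega>) = cnj (cross_moment M g f + cross_moment M g' f)"
    unfolding cross_moment_add_left[OF assms(2,3,1), symmetric] by (rule cross_moment_cnj[symmetric])
  then show ?thesis by (simp add: cross_moment_cnj)
qed

lemma cross_moment_scale_right:
  "cross_moment M f (\<lambda>\<omega>. c * g \<omega>) = cnj c * cross_moment M f g"
proof -
  have "cross_moment M f (\<lambda>\<omega>. c * g \<omega>) = cnj (c * cross_moment M g f)"
    by (simp only: cross_moment_scale_left[symmetric] cross_moment_cnj)
  then show ?thesis by (simp add: cross_moment_cnj)
qed

lemma cross_moment_sum_right:
  assumes "\<And>j. j \<in> J \<Longrightarrow> square_integrable M (g j)" "square_integrable M f"
  shows "cross_moment M f (\<lambda>\<omega>. \<Sum>j\<in>J. g j \<omega>) = (\<Sum>j\<in>J. cross_moment M f (g j))"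
proof -
  have "cross_moment M f (\<lambda>\<omega>. \<Sum>j\<in>J. g j \<omega>) = cnj (\<Sum>j\<in>J. cross_moment M (g j) f)"
    using cross_moment_cnj[of M "\<lambda>\<omega>. \<Sum>j\<in>J. g j \<omega>" f]
    by (simp only: cross_moment_sum_left[where f = g and g = f and J = J, OF assms])
  then show ?thesis by (simp add: cross_moment_cnj)
qed

lemma cross_moment_self: "cross_moment M f f = complex_of_real (\<integral>\<omega>. (cmod (f \<omega>))\<^sup>2 \<partial>M)"
  unfolding cross_moment_def by (simp add: complex_norm_square[symmetric] flip: integral_complex_of_real)

lemma cross_moment_hdot_left:
  assumes "\<And>k. square_integrable M (\<lambda>\<omega>. Y \<omega> $ k)" "square_integrable M g"
  shows "cross_moment M (\<lambda>\<omega>. hdot w (Y \<omega>)) g = hdot w (\<chi> k. cross_moment M (\<lambda>\<omega>. Y \<omega> $ k) g)"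
  unfolding hdot_def
  by (simp add: cross_moment_sum_left cross_moment_scale_left square_integrable_scale assms)

text \<open>
  The matrix of second moments of a random vector represents the second moments of all its linear
  functionals. This turns mean square errors into Hermitian forms.
\<close>

lemma cross_moment_hdot:
  assumes Y: "\<And>k. square_integrable M (\<lambda>\<omega>. Y \<omega> $ k)"
    and A: "\<And>k l. cross_moment M (\<lambda>\<omega>. Y \<omega> $ k) (\<lambda>\<omega>. Y \<omega> $ l) = A $ k $ l"
  shows "cross_moment M (\<lambda>\<omega>. hdot w (Y \<omega>)) (\<lambda>\<omega>. hdot v (Y \<omega>)) = hdot w (A *v v)"
proof -
  have "cross_moment M (\<lambda>\<omega>. Y \<omega> $ k) (\<lambda>\<omega>. hdot v (Y \<omega>)) = (A *v v) $ k" for k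
    unfolding hdot_def
    by (simp add: cross_moment_sum_right cross_moment_scale_right square_integrable_scale Y A
        matrix_vector_mult_def mult.commute)
  then show ?thesis
    by (simp add: cross_moment_hdot_left[OF Y square_integrable_hdot[OF Y]])
qed

text \<open>
  Second moments are positive semidefinite. If \<open>w\<^sup>H A w\<close> vanishes, then \<open>w\<^sup>H Y\<close> is almost surely 0,
  hence uncorrelated with every functional of \<open>Y\<close>; this says \<open>A w = 0\<close>, so invertibility gives
  \<open>w = 0\<close>.
\<close>

lemma positive_definite_second_moments:
  fixes A :: "complex^'m^'m"
  assumes Y: "\<And>k. square_integrable M (\<lambda>\<omega>. Y \<omega> $ k)"
    and A: "\<And>k l. cross_moment M (\<lambda>\<omega>. Y \<omega> $ k) (\<lambda>\<omega>. Y \<omega> $ l) = A $ k $ l"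
    and inv: "invertible A"
  shows "positive_definite A"
  unfolding positive_definite_def
proof (intro conjI allI impI)
  note moment = cross_moment_hdot[OF Y A]
  show "hdot u (A *v v) = hdot (A *v u) v" for u v
    using cross_moment_cnj[of M "\<lambda>\<omega>. hdot v (Y \<omega>)" "\<lambda>\<omega>. hdot u (Y \<omega>)"]
    by (simp add: moment cnj_hdot)
  fix w :: "complex^'m" assume "w \<noteq> 0"
  have form: "Re (hdot w (A *v w)) = (\<integral>\<omega>. (cmod (hdot w (Y \<omega>)))\<^sup>2 \<partial>M)"
    by (simp add: moment[symmetric] cross_moment_self)
  have sq: "integrable M (\<lambda>\<omega>. (cmod (hdot w (Y \<omega>)))\<^sup>2)"
    using square_integrable_hdot[OF Y, of w] by (simp add: square_integrable_def)
  show "0 < Re (hdot w (A *v w))"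
  proof (rule ccontr)
    assume "\<not> ?thesis"
    then have "(\<integral>\<omega>. (cmod (hdot w (Y \<omega>)))\<^sup>2 \<partial>M) = 0"
      using Bochner_Integration.integral_nonneg[of M "\<lambda>\<omega>. (cmod (hdot w (Y \<omega>)))\<^sup>2"]
      unfolding form by (simp add: not_less antisym)
    then have "AE \<omega> in M. hdot w (Y \<omega>) = 0"
      using integral_nonneg_eq_0_iff_AE[OF sq] by simp
    then have "cross_moment M (\<lambda>\<omega>. hdot v (Y \<omega>)) (\<lambda>\<omega>. hdot w (Y \<omega>)) = 0" for v
      unfolding cross_moment_def by (intro integral_eq_zero_AE) auto
    then have "A *v w = 0"
      by (intro hdot_left_eqI) (simp add: moment[symmetric], simp add: hdot_def)
    then have "matrix_inv A *v (A *v w) = 0" by simp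
    then have "w = 0"
      by (simp only: matrix_vector_mul_assoc matrix_inv_inverse[OF inv] matrix_vector_mul_lid
          matrix_vector_mult_0_right)
    with \<open>w \<noteq> 0\<close> show False by contradiction
  qed
qed

lemma cross_moment_diff_self:
  assumes "square_integrable M f" "square_integrable M g"
  shows "cross_moment M (\<lambda>\<omega>. f \<omega> - g \<omega>) (\<lambda>\<omega>. f \<omega> - g \<omega>)
    = cross_moment M f f - cross_moment M f g - cross_moment M g f + cross_moment M g g"
proof -
  note int = square_integrable_mult_cnj[OF assms(1,1)] square_integrable_mult_cnj[OF assms]
    square_integrable_mult_cnj[OF assms(2,1)] square_integrable_mult_cnj[OF assms(2,2)]
  have "cross_moment M (\<lambda>\<omega>. f \<omega> - g \<omega>) (\<lambda>\<omega>. f \<omega> - g \<omega>)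
      = (\<integral>\<omega>. f \<omega> * cnj (f \<omega>) - f \<omega> * cnj (g \<omega>) - g \<omega> * cnj (f \<omega>) + g \<omega> * cnj (g \<omega>) \<partial>M)"
    unfolding cross_moment_def by (simp add: algebra_simps)
  also have "\<dots> = cross_moment M f f - cross_moment M f g - cross_moment M g f + cross_moment M g g"
    unfolding cross_moment_def using int by simp
  finally show ?thesis .
qed

lemma (in prob_space) cross_moment_indep_centered:
  assumes ind: "indep_var borel f borel g" and int: "integrable M f" "integrable M g"
    and zero: "(\<integral>\<omega>. f \<omega> \<partial>M) = 0"
  shows "cross_moment M f g = 0"
proof -
  have "indep_var borel ((\<lambda>z. z) \<circ> f) borel (cnj \<circ> g)"
    by (intro indep_var_compose[OF ind] borel_measurable_continuous_onI continuous_on_cnj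
        continuous_on_id)
  then have "indep_var borel f borel (\<lambda>\<omega>. cnj (g \<omega>))"
    by (simp add: comp_def)
  then show ?thesis
    unfolding cross_moment_def using int zero by (simp add: indep_var_lebesgue_integral)
qed

section \<open>Conditional expectation given a random variable\<close>

text \<open>
  Taking real and imaginary parts commutes with the integrals over events, and for each part these
  integrals characterize the real conditional expectation.
\<close>

lemma (in prob_space) complex_cond_exp_eqI:
  assumes sub: "subalgebra M F"
    and f: "integrable M f" and g: "integrable M g" and gF: "g \<in> borel_measurable F"
    and eq: "\<And>A. A \<in> sets F \<Longrightarrow>
      (\<integral>\<omega>. indicator A \<omega> *\<^sub>R f \<omega> \<partial>M) = (\<integral>\<omega>. indicator A \<omega> *\<^sub>R g \<omega> \<partial>M)"
  shows "AE \<omega> in M. complex_cond_exp M F f \<omega> = g \<omega>"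
proof -
  interpret finite_measure_subalgebra M F
    by unfold_locales (rule sub)
  interpret sigma_finite_subalgebra M F
    by (rule finite_measure_subalgebra_is_sigma_finite) unfold_locales
  have int: "integrable M (\<lambda>\<omega>. indicator A \<omega> *\<^sub>R u \<omega>)"
    if "A \<in> sets F" "integrable M u" for A and u :: "'a \<Rightarrow> complex"
    using that sub by (intro integrable_mult_indicator) (auto simp: subalgebra_def)
  have re: "(LINT \<omega>:A|M. Re (f \<omega>)) = (LINT \<omega>:A|M. Re (g \<omega>))"
    and im: "(LINT \<omega>:A|M. Im (f \<omega>)) = (LINT \<omega>:A|M. Im (g \<omega>))" if "A \<in> sets F" for A
    using arg_cong[OF eq[OF that], of Re] arg_cong[OF eq[OF that], of Im]
    by (simp_all add: set_lebesgue_integral_def int that f g flip: integral_Re integral_Im)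
  have "AE \<omega> in M. real_cond_exp M F (\<lambda>\<omega>. Re (f \<omega>)) \<omega> = Re (g \<omega>)"
    by (intro real_cond_exp_charact re) (use f g gF in auto)
  moreover have "AE \<omega> in M. real_cond_exp M F (\<lambda>\<omega>. Im (f \<omega>)) \<omega> = Im (g \<omega>)"
    by (intro real_cond_exp_charact im) (use f g gF in auto)
  ultimately show ?thesis
    by eventually_elim (simp add: complex_cond_exp_def)
qed

text \<open>
  An event generated by \<open>W\<close> has an indicator of the form \<open>indicator B (W \<omega>)\<close>, which is independent
  of \<open>Z\<close>; the integral is then a product with the factor \<open>E[Z] = 0\<close>. The indicator is regarded
  as a complex random variable, since the product rule for expectations is about two variables of
  one type.
\<close>

lemma (in prob_space) indep_var_integral_on_event:
  fixes Z W :: "'a \<Rightarrow> complex"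
  assumes ind: "indep_var borel Z borel W" and Z: "integrable M Z" "(\<integral>\<omega>. Z \<omega> \<partial>M) = 0"
    and A: "A \<in> sets (vimage_algebra (space M) W borel)"
  shows "(\<integral>\<omega>. indicator A \<omega> *\<^sub>R Z \<omega> \<partial>M) = 0"
proof -
  obtain B where B: "B \<in> sets borel" "A = W -` B \<inter> space M"
    using A by (auto simp: sets_vimage_algebra2)
  let ?I = "\<lambda>z. complex_of_real (indicator B z)"
  have W: "W \<in> borel_measurable M" and "Z \<in> borel_measurable M"
    using indep_var_rv1[OF ind] indep_var_rv2[OF ind] by auto
  have "indep_var borel ((\<lambda>z. z) \<circ> Z) borel (?I \<circ> W)"
    using B(1) by (intro indep_var_compose[OF ind]) auto
  then have "indep_var borel Z borel (\<lambda>\<omega>. ?I (W \<omega>))"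
    by (simp add: comp_def)
  moreover have "integrable M (\<lambda>\<omega>. ?I (W \<omega>))"
    by (rule integrable_const_bound[of _ 1]) (use B(1) W in \<open>auto simp: indicator_def\<close>)
  ultimately have "(\<integral>\<omega>. Z \<omega> * ?I (W \<omega>) \<partial>M) = 0"
    using Z by (simp add: indep_var_lebesgue_integral)
  moreover have "(\<integral>\<omega>. indicator A \<omega> *\<^sub>R Z \<omega> \<partial>M) = (\<integral>\<omega>. Z \<omega> * ?I (W \<omega>) \<partial>M)"
    by (intro Bochner_Integration.integral_cong) (auto simp: B(2) indicator_def)
  ultimately show ?thesis by simp
qed

text \<open>
  The hypothesis on \<open>R\<close> is stated through integrals rather than as independence of \<open>R\<close> and \<open>W\<close>,
  because in this form it is additive: a sum of remainders inherits it from its summands.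
\<close>

lemma (in prob_space) complex_cond_exp_affine:
  fixes W R :: "'a \<Rightarrow> complex"
  assumes W: "integrable M W" and R: "integrable M R"
    and zero: "\<And>A. A \<in> sets (vimage_algebra (space M) W borel) \<Longrightarrow>
      (\<integral>\<omega>. indicator A \<omega> *\<^sub>R R \<omega> \<partial>M) = 0"
  shows "AE \<omega> in M. complex_cond_exp M (vimage_algebra (space M) W borel)
    (\<lambda>\<omega>. a * W \<omega> + b + R \<omega>) \<omega> = a * W \<omega> + b"
proof (rule complex_cond_exp_eqI)
  let ?F = "vimage_algebra (space M) W borel"
  show sub: "subalgebra M ?F"
    unfolding subalgebra_def
    using sets_image_in_sets[OF refl, of W M borel] borel_measurable_integrable[OF W] by simp
  have WF: "W \<in> borel_measurable ?F"
    by (rule measurable_vimage_algebra1) auto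
  then show "(\<lambda>\<omega>. a * W \<omega> + b) \<in> borel_measurable ?F"
    by measurable
  show aff: "integrable M (\<lambda>\<omega>. a * W \<omega> + b)" and "integrable M (\<lambda>\<omega>. a * W \<omega> + b + R \<omega>)"
    using W R by auto
  fix A assume A: "A \<in> sets ?F"
  then have AM: "A \<in> sets M" using sub by (auto simp: subalgebra_def)
  have "(\<integral>\<omega>. indicator A \<omega> *\<^sub>R (a * W \<omega> + b + R \<omega>) \<partial>M)
      = (\<integral>\<omega>. indicator A \<omega> *\<^sub>R (a * W \<omega> + b) + indicator A \<omega> *\<^sub>R R \<omega> \<partial>M)"
    by (simp add: scaleR_add_right)
  also have "\<dots> = (\<integral>\<omega>. indicator A \<omega> *\<^sub>R (a * W \<omega> + b) \<partial>M)
      + (\<integral>\<omega>. indicator A \<omega> *\<^sub>R R \<omega> \<partial>M)"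
    by (intro Bochner_Integration.integral_add integrable_mult_indicator AM aff R)
  finally show "(\<integral>\<omega>. indicator A \<omega> *\<^sub>R (a * W \<omega> + b + R \<omega>) \<partial>M)
      = (\<integral>\<omega>. indicator A \<omega> *\<^sub>R (a * W \<omega> + b) \<partial>M)"
    by (simp add: zero[OF A])
qed

section \<open>Components of random vectors\<close>

lemma measurable_vec_nth:
  fixes f :: "'a \<Rightarrow> complex^'n"
  assumes "f \<in> borel_measurable M"
  shows "(\<lambda>\<omega>. f \<omega> $ i) \<in> borel_measurable M"
  using assms by (rule measurable_compose)
    (intro borel_measurable_continuous_onI continuous_on_component continuous_on_id)

lemma integral_vec_nth:
  fixes f :: "'a \<Rightarrow> complex^'n"
  assumes f: "f \<in> borel_measurable M" and int: "\<And>i. integrable M (\<lambda>\<omega>. f \<omega> $ i)"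
  shows "(\<integral>\<omega>. f \<omega> \<partial>M) = (\<chi> i. \<integral>\<omega>. f \<omega> $ i \<partial>M)"
proof -
  have "norm v \<le> (\<Sum>i\<in>UNIV. cmod (v $ i))" for v :: "complex^'n"
    unfolding norm_vec_def by (rule L2_set_le_sum) simp
  then have "integrable M f"
    by (intro Bochner_Integration.integrable_bound[OF _ f, of "\<lambda>\<omega>. \<Sum>i\<in>UNIV. cmod (f \<omega> $ i)"])
      (auto simp: int intro!: AE_I2 order_trans[OF _ abs_ge_self])
  then show ?thesis
    by (simp add: vec_eq_iff integral_bounded_linear[OF bounded_linear_vec_nth])
qed

text \<open>
  A component of a vector generates a smaller sigma-algebra than the vector. Components share the
  value type \<open>complex\<close>, so the product rule for expectations becomes available. The order of \<open>u\<close> and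
  \<open>v\<close> is exchanged to match the later use, where the second variable is conditioned on.
\<close>

lemma (in prob_space) indep_rv_components:
  fixes u :: "'a \<Rightarrow> complex^'n" and v :: "'a \<Rightarrow> complex^'m"
  assumes ind: "indep_rv M u v" and u: "u \<in> borel_measurable M" and v: "v \<in> borel_measurable M"
  shows "indep_var borel (\<lambda>\<omega>. v \<omega> $ k) borel (\<lambda>\<omega>. u \<omega> $ i)"
proof -
  have sub: "sigma_sets (space M) {(\<lambda>\<omega>. f \<omega> $ j) -` A \<inter> space M | A. A \<in> sets borel}
      \<subseteq> sets (vimage_algebra (space M) f borel)" for f :: "'a \<Rightarrow> complex^'l" and j
  proof -
    have "(\<lambda>\<omega>. f \<omega> $ j) \<in> borel_measurable (vimage_algebra (space M) f borel)"
      by (intro measurable_vec_nth measurable_vimage_algebra1) auto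
    from sets_image_in_sets[OF refl this] show ?thesis
      by (simp add: sets_vimage_algebra)
  qed
  show ?thesis
    unfolding indep_var_eq
  proof (intro conjI measurable_vec_nth u v)
    show "indep_set (sigma_sets (space M) {(\<lambda>\<omega>. v \<omega> $ k) -` A \<inter> space M | A. A \<in> sets borel})
        (sigma_sets (space M) {(\<lambda>\<omega>. u \<omega> $ i) -` A \<inter> space M | A. A \<in> sets borel})"
      using ind sub[of v k] sub[of u i] unfolding indep_rv_def indep_sets2_eq
      by (metis (no_types, lifting) Int_commute mult.commute subset_iff)
  qed
qed

lemma (in prob_space) indep_vars_pair:
  assumes ind: "indep_vars (\<lambda>_. N) X UNIV" and "j \<noteq> i"
  shows "indep_var N (X j) N (X i)"
proof -
  have "indep_var (PiM {j} (\<lambda>_. N)) (\<lambda>\<omega>. restrict (\<lambda>l. X l \<omega>) {j})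
      (PiM {i} (\<lambda>_. N)) (\<lambda>\<omega>. restrict (\<lambda>l. X l \<omega>) {i})"
    using assms(2) by (intro indep_var_restrict[OF ind]) auto
  then have "indep_var N ((\<lambda>f. f j) \<circ> (\<lambda>\<omega>. restrict (\<lambda>l. X l \<omega>) {j}))
      N ((\<lambda>f. f i) \<circ> (\<lambda>\<omega>. restrict (\<lambda>l. X l \<omega>) {i}))"
    by (rule indep_var_compose) (auto intro: measurable_component_singleton)
  then show ?thesis by (simp add: comp_def)
qed

section \<open>The linear observation model\<close>

text \<open>
  Independence is assumed in the form in which it acts: conditional expectations and second moments
  treat the summands of an estimate one at a time, so each condition relates two scalar variables.
\<close>

locale linear_observation = prob_space M for M :: "'a measure" +
  fixes x :: "'a \<Rightarrow> complex^'n" and noise :: "'a \<Rightarrow> complex^'m" and H :: "complex^'n^'m"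
  assumes x_square_integrable: "\<And>i. square_integrable M (\<lambda>\<omega>. x \<omega> $ i)"
    and noise_square_integrable: "\<And>k. square_integrable M (\<lambda>\<omega>. noise \<omega> $ k)"
    and x_indep: "\<And>i j. j \<noteq> i \<Longrightarrow> indep_var borel (\<lambda>\<omega>. x \<omega> $ j) borel (\<lambda>\<omega>. x \<omega> $ i)"
    and noise_indep: "\<And>k i. indep_var borel (\<lambda>\<omega>. noise \<omega> $ k) borel (\<lambda>\<omega>. x \<omega> $ i)"
    and noise_centered: "\<And>k. (\<integral>\<omega>. noise \<omega> $ k \<partial>M) = 0"
begin

definition mean :: "complex^'n" where
  "mean = (\<chi> i. \<integral>\<omega>. x \<omega> $ i \<partial>M)"

definition deviation :: "'n \<Rightarrow> 'a \<Rightarrow> complex" where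
  "deviation i \<omega> = x \<omega> $ i - mean $ i"

definition obs :: "'a \<Rightarrow> complex^'m" where
  "obs \<omega> = H *v x \<omega> + noise \<omega>"

definition centered_obs :: "'a \<Rightarrow> complex^'m" where
  "centered_obs \<omega> = H *v (\<chi> j. deviation j \<omega>) + noise \<omega>"

abbreviation variance_of :: "'n \<Rightarrow> real" where
  "variance_of i \<equiv> complex_variance M (\<lambda>\<omega>. x \<omega> $ i)"

definition obs_cov :: "complex^'m^'m" where
  "obs_cov = H ** (\<chi> i j. if i = j then of_real (variance_of i) else 0) ** conj_transpose H
     + (\<chi> k l. cross_moment M (\<lambda>\<omega>. noise \<omega> $ k) (\<lambda>\<omega>. noise \<omega> $ l))"

lemma obs_eq: "obs \<omega> = H *v mean + centered_obs \<omega>"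
proof -
  have "x \<omega> = mean + (\<chi> j. deviation j \<omega>)"
    by (simp add: vec_eq_iff deviation_def)
  then show ?thesis
    by (simp add: obs_def centered_obs_def matrix_vector_right_distrib)
qed

lemma deviation_square_integrable: "square_integrable M (deviation i)"
  unfolding deviation_def [abs_def]
  by (intro square_integrable_diff x_square_integrable square_integrable_const)

lemma deviation_centered: "(\<integral>\<omega>. deviation i \<omega> \<partial>M) = 0"
  using square_integrable_integrable[OF x_square_integrable]
  by (simp add: deviation_def mean_def prob_space)

lemma deviation_indep:
  assumes "j \<noteq> i"
  shows "indep_var borel (deviation j) borel (\<lambda>\<omega>. x \<omega> $ i)"
proof -
  have "indep_var borel ((\<lambda>z. z - mean $ j) \<circ> (\<lambda>\<omega>. x \<omega> $ j)) borel ((\<lambda>z. z) \<circ> (\<lambda>\<omega>. x \<omega> $ i))"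
    by (intro indep_var_compose[OF x_indep[OF assms]]) auto
  then show ?thesis
    by (simp add: comp_def deviation_def [abs_def])
qed

text \<open>
  A centered variable is orthogonal to the constants, so the mean of \<open>x\<^sub>i\<close> drops out; independence
  assumptions, which are about \<open>x\<^sub>i\<close> itself, then apply.
\<close>

lemma cross_moment_centered_deviation:
  assumes "(\<integral>\<omega>. f \<omega> \<partial>M) = 0" "square_integrable M f"
  shows "cross_moment M f (deviation i) = cross_moment M f (\<lambda>\<omega>. x \<omega> $ i)"
proof -
  have "cross_moment M f (deviation i) =
      (\<integral>\<omega>. f \<omega> * cnj (x \<omega> $ i) - f \<omega> * cnj (mean $ i) \<partial>M)"
    unfolding cross_moment_def deviation_def by (simp add: algebra_simps)
  also have "\<dots> = cross_moment M f (\<lambda>\<omega>. x \<omega> $ i)"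
    unfolding cross_moment_def
    using assms square_integrable_integrable[OF assms(2)]
      square_integrable_mult_cnj[OF assms(2) x_square_integrable] by simp
  finally show ?thesis .
qed

lemma cross_moment_deviation:
  "cross_moment M (deviation j) (deviation i) = (if j = i then of_real (variance_of i) else 0)"
proof (cases "j = i")
  case True
  then show ?thesis
    by (simp add: cross_moment_self complex_variance_def deviation_def mean_def)
next
  case False
  note int = square_integrable_integrable[OF deviation_square_integrable]
    square_integrable_integrable[OF x_square_integrable]
  show ?thesis
    using False cross_moment_indep_centered[OF deviation_indep[OF False] int deviation_centered]
    by (simp add: cross_moment_centered_deviation deviation_centered deviation_square_integrable)
qed

lemma cross_moment_noise_deviation:
  "cross_moment M (\<lambda>\<omega>. noise \<omega> $ k) (deviation i) = 0"
proof -
  note int = square_integrable_integrable[OF noise_square_integrable]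
    square_integrable_integrable[OF x_square_integrable]
  show ?thesis
    using cross_moment_indep_centered[OF noise_indep int noise_centered]
    by (simp add: cross_moment_centered_deviation noise_centered noise_square_integrable)
qed

lemma cross_moment_deviation_noise:
  "cross_moment M (deviation i) (\<lambda>\<omega>. noise \<omega> $ k) = 0"
  using cross_moment_noise_deviation[of k i] by (subst cross_moment_cnj[symmetric]) simp

lemma centered_obs_nth:
  "centered_obs \<omega> $ k = (\<Sum>j\<in>UNIV. H $ k $ j * deviation j \<omega>) + noise \<omega> $ k"
  by (simp add: centered_obs_def matrix_vector_mult_def)

lemma signal_square_integrable:
  "square_integrable M (\<lambda>\<omega>. \<Sum>j\<in>UNIV. H $ k $ j * deviation j \<omega>)"
  by (intro square_integrable_sum square_integrable_scale deviation_square_integrable)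

lemma centered_obs_square_integrable: "square_integrable M (\<lambda>\<omega>. centered_obs \<omega> $ k)"
  unfolding centered_obs_nth
  by (intro square_integrable_add signal_square_integrable noise_square_integrable)

lemma cross_moment_obs_deviation:
  "cross_moment M (\<lambda>\<omega>. centered_obs \<omega> $ k) (deviation i) = of_real (variance_of i) * H $ k $ i"
proof -
  have "cross_moment M (\<lambda>\<omega>. centered_obs \<omega> $ k) (deviation i) =
      (\<Sum>j\<in>UNIV. H $ k $ j * cross_moment M (deviation j) (deviation i))"
    unfolding centered_obs_nth
    by (simp add: cross_moment_add_left cross_moment_sum_left cross_moment_scale_left
        signal_square_integrable noise_square_integrable deviation_square_integrable
        square_integrable_scale cross_moment_noise_deviation)
  also have "\<dots> = (\<Sum>j\<in>UNIV. if j = i then of_real (variance_of i) * H $ k $ i else 0)"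
    by (intro sum.cong) (auto simp: cross_moment_deviation)
  finally show ?thesis by simp
qed

text \<open>
  Signal and noise are uncorrelated, so their covariance matrices add up; the one of the signal is
  \<open>H Cxx H\<^sup>H\<close> with a diagonal \<open>Cxx\<close>, because the parameters are pairwise uncorrelated.
\<close>

lemma cross_moment_obs:
  "cross_moment M (\<lambda>\<omega>. centered_obs \<omega> $ k) (\<lambda>\<omega>. centered_obs \<omega> $ l) = obs_cov $ k $ l"
proof -
  let ?N = "\<lambda>k \<omega>. noise \<omega> $ k"
  have noise: "cross_moment M (\<lambda>\<omega>. centered_obs \<omega> $ k) (?N l) = cross_moment M (?N k) (?N l)"
    unfolding centered_obs_nth
    by (simp add: cross_moment_add_left cross_moment_sum_left cross_moment_scale_left
        signal_square_integrable noise_square_integrable deviation_square_integrable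
        square_integrable_scale cross_moment_deviation_noise)
  have "cross_moment M (\<lambda>\<omega>. centered_obs \<omega> $ k) (\<lambda>\<omega>. centered_obs \<omega> $ l) =
      cross_moment M (\<lambda>\<omega>. centered_obs \<omega> $ k)
        (\<lambda>\<omega>. (\<Sum>j\<in>UNIV. H $ l $ j * deviation j \<omega>) + noise \<omega> $ l)"
    by (simp only: centered_obs_nth[of _ l])
  also have "\<dots> = (\<Sum>j\<in>UNIV. cnj (H $ l $ j) * (of_real (variance_of j) * H $ k $ j))
      + cross_moment M (?N k) (?N l)"
    by (simp add: cross_moment_add_right cross_moment_sum_right cross_moment_scale_right
        centered_obs_square_integrable signal_square_integrable noise_square_integrable
        deviation_square_integrable square_integrable_scale noise cross_moment_obs_deviation)
  also have "(\<Sum>j\<in>UNIV. cnj (H $ l $ j) * (of_real (variance_of j) * H $ k $ j)) =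
      (H ** (\<chi> i j. if i = j then of_real (variance_of i) else 0) ** conj_transpose H) $ k $ l"
  proof -
    have "(H ** (\<chi> i j. if i = j then complex_of_real (variance_of i) else 0)) $ k $ j
        = H $ k $ j * of_real (variance_of j)" for j
    proof -
      have "(H ** (\<chi> i j. if i = j then complex_of_real (variance_of i) else 0)) $ k $ j
          = (\<Sum>i\<in>UNIV. if i = j then H $ k $ j * of_real (variance_of j) else 0)"
        by (simp add: matrix_matrix_mult_def if_distrib cong: if_cong)
      then show ?thesis by simp
    qed
    then show ?thesis
      by (subst matrix_matrix_mult_def) (simp add: conj_transpose_def mult_ac)
  qed
  finally show ?thesis
    by (simp add: obs_cov_def)
qed

lemma hdot_centered_obs:
  "hdot w (centered_obs \<omega>) =
     (\<Sum>j\<in>UNIV. hdot w (column j H) * deviation j \<omega>) + hdot w (noise \<omega>)"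
  by (simp add: centered_obs_def hdot_add_right hdot_matrix_vector)

text \<open>
  The estimate equals \<open>a x\<^sub>i + b + (S + N)\<close>, where \<open>S\<close> collects the deviations of the other parameters
  and \<open>N\<close> the noise. Each of their summands is centered and independent of \<open>x\<^sub>i\<close>, so its integral
  over an event generated by \<open>x\<^sub>i\<close> vanishes.
\<close>

lemma cond_exp_affine_estimate:
  fixes w :: "complex^'m" and c :: complex and i :: 'n
  defines "a \<equiv> hdot w (column i H)"
  defines "b \<equiv> hdot w (H *v mean) + c - a * mean $ i"
  shows "AE \<omega> in M. complex_cond_exp M (vimage_algebra (space M) (\<lambda>\<omega>. x \<omega> $ i) borel)
    (\<lambda>\<omega>. hdot w (obs \<omega>) + c) \<omega> = a * x \<omega> $ i + b"
proof -
  define S where "S \<omega> = (\<Sum>j\<in>UNIV - {i}. hdot w (column j H) * deviation j \<omega>)" for \<omega>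
  define N where "N \<omega> = (\<Sum>k\<in>UNIV. cnj (w $ k) * noise \<omega> $ k)" for \<omega>
  note dev_int = square_integrable_integrable[OF deviation_square_integrable]
  note noise_int = square_integrable_integrable[OF noise_square_integrable]
  have S_int: "integrable M S"
    unfolding S_def using dev_int by (intro Bochner_Integration.integrable_sum integrable_mult_right)
  have N_int: "integrable M N"
    unfolding N_def using noise_int by (intro Bochner_Integration.integrable_sum integrable_mult_right)
  have split: "hdot w (obs \<omega>) + c = a * x \<omega> $ i + b + (S \<omega> + N \<omega>)" for \<omega>
  proof -
    have "(\<Sum>j\<in>UNIV. hdot w (column j H) * deviation j \<omega>) = a * deviation i \<omega> + S \<omega>"
      unfolding S_def a_def by (rule sum.remove) auto
    then show ?thesis
      by (simp add: obs_eq hdot_add_right hdot_centered_obs N_def[symmetric] hdot_def[of w "noise \<omega>"]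
          b_def deviation_def algebra_simps)
  qed
  show ?thesis
    unfolding split
  proof (rule complex_cond_exp_affine)
    show "integrable M (\<lambda>\<omega>. x \<omega> $ i)"
      by (rule square_integrable_integrable[OF x_square_integrable])
    show "integrable M (\<lambda>\<omega>. S \<omega> + N \<omega>)"
      using S_int N_int by simp
    fix A assume A: "A \<in> sets (vimage_algebra (space M) (\<lambda>\<omega>. x \<omega> $ i) borel)"
    have "(\<lambda>\<omega>. x \<omega> $ i) \<in> borel_measurable M"
      using square_integrable_measurable[OF x_square_integrable] .
    then have AM: "A \<in> sets M"
      using A sets_image_in_sets[OF refl, of "\<lambda>\<omega>. x \<omega> $ i" M borel] by blast
    have pull: "(\<integral>\<omega>. indicator A \<omega> *\<^sub>R (d * f \<omega>) \<partial>M) = d * (\<integral>\<omega>. indicator A \<omega> *\<^sub>R f \<omega> \<partial>M)"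
      for d and f :: "'a \<Rightarrow> complex"
      by (simp only: mult_scaleR_right[symmetric] integral_mult_right_zero)
    have dev0: "(\<integral>\<omega>. indicator A \<omega> *\<^sub>R deviation j \<omega> \<partial>M) = 0" if "j \<noteq> i" for j
      by (rule indep_var_integral_on_event[OF deviation_indep[OF that] dev_int deviation_centered A])
    have noise0: "(\<integral>\<omega>. indicator A \<omega> *\<^sub>R (noise \<omega> $ k) \<partial>M) = 0" for k
      by (rule indep_var_integral_on_event[OF noise_indep noise_int noise_centered A])
    have "(\<integral>\<omega>. indicator A \<omega> *\<^sub>R (S \<omega> + N \<omega>) \<partial>M) =
        (\<integral>\<omega>. indicator A \<omega> *\<^sub>R S \<omega> \<partial>M) + (\<integral>\<omega>. indicator A \<omega> *\<^sub>R N \<omega> \<partial>M)"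
      unfolding scaleR_add_right
      by (intro Bochner_Integration.integral_add integrable_mult_indicator AM S_int N_int)
    also have "(\<integral>\<omega>. indicator A \<omega> *\<^sub>R S \<omega> \<partial>M) =
        (\<Sum>j\<in>UNIV - {i}. hdot w (column j H) * (\<integral>\<omega>. indicator A \<omega> *\<^sub>R deviation j \<omega> \<partial>M))"
      unfolding S_def scaleR_sum_right pull[symmetric]
      by (intro Bochner_Integration.integral_sum integrable_mult_indicator integrable_mult_right AM
          dev_int)
    also have "\<dots> = 0" using dev0 by simp
    also have "(\<integral>\<omega>. indicator A \<omega> *\<^sub>R N \<omega> \<partial>M) =
        (\<Sum>k\<in>UNIV. cnj (w $ k) * (\<integral>\<omega>. indicator A \<omega> *\<^sub>R (noise \<omega> $ k) \<partial>M))"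
      unfolding N_def scaleR_sum_right pull[symmetric]
      by (intro Bochner_Integration.integral_sum integrable_mult_indicator integrable_mult_right AM
          noise_int)
    also have "\<dots> = 0" using noise0 by simp
    finally show "(\<integral>\<omega>. indicator A \<omega> *\<^sub>R (S \<omega> + N \<omega>) \<partial>M) = 0" by simp
  qed
qed

text \<open>
  Taking expectations gives \<open>a m + b = m\<close> for the mean \<open>m\<close> of \<open>x\<^sub>i\<close>. Subtracting it leaves
  \<open>(a - 1) (x\<^sub>i - m) = 0\<close> almost surely, and pairing with \<open>x\<^sub>i - m\<close> leaves \<open>(a - 1) \<sigma>\<^sub>i\<^sup>2 = 0\<close>.
\<close>

lemma affine_identity_iff:
  assumes "variance_of i > 0"
  shows "(AE \<omega> in M. a * x \<omega> $ i + b = x \<omega> $ i) \<longleftrightarrow> a = 1 \<and> b = 0"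
proof
  assume ae: "AE \<omega> in M. a * x \<omega> $ i + b = x \<omega> $ i"
  have x_int: "integrable M (\<lambda>\<omega>. x \<omega> $ i)"
    by (rule square_integrable_integrable[OF x_square_integrable])
  have "(\<integral>\<omega>. a * x \<omega> $ i + b \<partial>M) = (\<integral>\<omega>. x \<omega> $ i \<partial>M)"
    using ae x_int borel_measurable_integrable[OF x_int] by (intro integral_cong_AE) auto
  then have mean: "a * mean $ i + b = mean $ i"
    using x_int by (simp add: mean_def prob_space)
  have "AE \<omega> in M. (a - 1) * deviation i \<omega> = 0"
    using ae
  proof eventually_elim
    case (elim \<omega>)
    have "(a - 1) * deviation i \<omega> = (a * x \<omega> $ i + b - x \<omega> $ i) - (a * mean $ i + b - mean $ i)"
      by (simp add: deviation_def algebra_simps)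
    then show ?case by (simp add: elim mean)
  qed
  then have "cross_moment M (\<lambda>\<omega>. (a - 1) * deviation i \<omega>) (deviation i) = 0"
    unfolding cross_moment_def by (intro integral_eq_zero_AE) auto
  then have "a = 1"
    using assms by (simp add: cross_moment_scale_left cross_moment_deviation)
  with mean show "a = 1 \<and> b = 0" by simp
qed simp

text \<open>
  The second equation says that the estimate has the mean of \<open>x\<^sub>i\<close>; the offset in
  \<open>cond_exp_affine_estimate\<close> reduces to it once the slope is 1.
\<close>

lemma cwcu_iff:
  assumes g: "\<And>z. g z $ i = hdot w z + c" and var: "variance_of i > 0"
  shows "cwcu M x obs i g \<longleftrightarrow>
    hdot w (column i H) = 1 \<and> hdot w (H *v mean) + c = mean $ i"
proof -
  define a where "a = hdot w (column i H)"
  define b where "b = hdot w (H *v mean) + c - a * mean $ i"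
  have ce: "AE \<omega> in M. complex_cond_exp M (vimage_algebra (space M) (\<lambda>\<omega>. x \<omega> $ i) borel)
      (\<lambda>\<omega>. g (obs \<omega>) $ i) \<omega> = a * x \<omega> $ i + b"
    unfolding g a_def b_def by (rule cond_exp_affine_estimate)
  have "cwcu M x obs i g \<longleftrightarrow> (AE \<omega> in M. a * x \<omega> $ i + b = x \<omega> $ i)"
    unfolding cwcu_def
  proof
    assume "AE \<omega> in M. complex_cond_exp M (vimage_algebra (space M) (\<lambda>\<omega>. x \<omega> $ i) borel)
      (\<lambda>\<omega>. g (obs \<omega>) $ i) \<omega> = x \<omega> $ i"
    with ce show "AE \<omega> in M. a * x \<omega> $ i + b = x \<omega> $ i"
      by eventually_elim simp
  next
    assume "AE \<omega> in M. a * x \<omega> $ i + b = x \<omega> $ i"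
    with ce show "AE \<omega> in M. complex_cond_exp M (vimage_algebra (space M) (\<lambda>\<omega>. x \<omega> $ i) borel)
      (\<lambda>\<omega>. g (obs \<omega>) $ i) \<omega> = x \<omega> $ i"
      by eventually_elim simp
  qed
  also have "\<dots> \<longleftrightarrow> a = 1 \<and> b = 0"
    by (rule affine_identity_iff[OF var])
  also have "\<dots> \<longleftrightarrow> a = 1 \<and> hdot w (H *v mean) + c = mean $ i"
    by (auto simp: b_def)
  finally show ?thesis by (simp add: a_def)
qed

text \<open>
  The cross term \<open>E[w\<^sup>H (y - E[y]) (x\<^sub>i - E[x\<^sub>i])\<^sup>*] = \<sigma>\<^sub>i\<^sup>2 w\<^sup>H h\<close> and its
  conjugate are equal to \<open>\<sigma>\<^sub>i\<^sup>2\<close> by the constraint. Both are subtracted, and the variance of \<open>x\<^sub>i\<close> is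
  added once.
\<close>

lemma bayes_mse_eq:
  assumes g: "\<And>z. g z $ i = hdot w z + c"
    and w: "hdot w (column i H) = 1" and c: "hdot w (H *v mean) + c = mean $ i"
  shows "bayes_mse M x obs i g = Re (hdot w (obs_cov *v w)) - variance_of i"
proof -
  let ?e = "\<lambda>\<omega>. hdot w (centered_obs \<omega>)"
  have e: "square_integrable M ?e"
    by (rule square_integrable_hdot[OF centered_obs_square_integrable])
  have diff: "g (obs \<omega>) $ i - x \<omega> $ i = ?e \<omega> - deviation i \<omega>" for \<omega>
    using c by (simp add: g obs_eq hdot_add_right deviation_def algebra_simps)
  have "(\<chi> k. cross_moment M (\<lambda>\<omega>. centered_obs \<omega> $ k) (deviation i))
      = of_real (variance_of i) *s column i H"
    by (simp add: vec_eq_iff cross_moment_obs_deviation column_def)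
  then have ed: "cross_moment M ?e (deviation i) = of_real (variance_of i)"
    by (simp add: cross_moment_hdot_left centered_obs_square_integrable
        deviation_square_integrable hdot_scale_right w)
  then have de: "cross_moment M (deviation i) ?e = of_real (variance_of i)"
    by (subst cross_moment_cnj[symmetric]) simp
  have ee: "cross_moment M ?e ?e = hdot w (obs_cov *v w)"
    by (rule cross_moment_hdot[OF centered_obs_square_integrable cross_moment_obs])
  have "complex_of_real (bayes_mse M x obs i g) =
      cross_moment M (\<lambda>\<omega>. ?e \<omega> - deviation i \<omega>) (\<lambda>\<omega>. ?e \<omega> - deviation i \<omega>)"
    unfolding bayes_mse_def diff cross_moment_self ..
  also have "\<dots> = hdot w (obs_cov *v w) - of_real (variance_of i)"
    by (simp add: cross_moment_diff_self[OF e deviation_square_integrable] ee ed de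
        cross_moment_deviation)
  finally show ?thesis
    by (metis Re_complex_of_real minus_complex.sel(1))
qed

end

section \<open>The component-wise conditionally unbiased estimator\<close>

text \<open>
  Component \<open>i\<close> of the constraint and of the error involves only component \<open>i\<close> of the estimator, so the
  problem splits into one constrained minimization per component. A competitor that does as well as
  the optimum for one \<open>i\<close> agrees with it in that component; uniqueness follows by collecting all \<open>i\<close>.
\<close>

lemma (in linear_observation) cwcu_lmmse_iff:
  assumes var: "\<And>i. variance_of i > 0"
    and pd: "positive_definite obs_cov" and inv: "invertible obs_cov"
    and nz: "\<And>i. column i H \<noteq> 0"
    and E: "\<And>i z. (E *v z) $ i = hdot (constrained_minimizer obs_cov (column i H)) z"
  shows "is_cwcu_lmmse M x obs g \<longleftrightarrow> g = (\<lambda>z. mean + E *v (z - H *v mean))"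
proof -
  define opt where "opt z = mean + E *v (z - H *v mean)" for z
  define s where "s i = constrained_minimizer obs_cov (column i H)" for i
  \<comment> \<open>The offset is forced by the mean condition of \<open>cwcu_iff\<close>.\<close>
  define c where "c i = mean $ i - hdot (s i) (H *v mean)" for i
  have opt_nth: "opt z $ i = hdot (s i) z + c i" for z i
    by (simp add: opt_def E s_def c_def hdot_diff_right)
  have opt_affine: "affine_estimator opt"
    unfolding affine_estimator_def
    by (rule exI[of _ E], rule exI[of _ "mean - E *v (H *v mean)"])
      (simp add: opt_def fun_eq_iff matrix_vector_mult_diff_distrib)
  have feasible: "hdot (s i) (column i H) = 1" "hdot (s i) (H *v mean) + c i = mean $ i" for i
    using constrained_minimizer_feasible[OF pd inv nz] by (simp_all add: s_def c_def)
  have opt_cwcu: "cwcu M x obs i opt" for i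
    using cwcu_iff[where g = opt, OF opt_nth var] feasible by blast
  have opt_mse: "bayes_mse M x obs i opt = Re (hdot (s i) (obs_cov *v s i)) - variance_of i" for i
    by (rule bayes_mse_eq[where g = opt, OF opt_nth feasible])
  have competitor: "bayes_mse M x obs i opt \<le> bayes_mse M x obs i h \<and>
      (bayes_mse M x obs i h \<le> bayes_mse M x obs i opt \<longrightarrow> (\<forall>z. h z $ i = opt z $ i))"
    if affine: "affine_estimator h" and unbiased: "cwcu M x obs i h" for h i
  proof -
    obtain E' c' where h: "h = (\<lambda>z. E' *v z + c')"
      using affine unfolding affine_estimator_def by blast
    \<comment> \<open>The conjugate is needed because \<open>hdot\<close> conjugates its first argument again.\<close>
    define w where "w = (\<chi> k. cnj (E' $ i $ k))"
    have h_nth: "h z $ i = hdot w z + c' $ i" for z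
      by (simp add: h w_def matrix_vector_nth_hdot)
    have con: "hdot w (column i H) = 1" "hdot w (H *v mean) + c' $ i = mean $ i"
      using unbiased cwcu_iff[where g = h, OF h_nth var] by blast+
    have mse: "bayes_mse M x obs i h = Re (hdot w (obs_cov *v w)) - variance_of i"
      by (rule bayes_mse_eq[where g = h, OF h_nth con])
    note minimum = constrained_form_minimum[OF pd inv nz con(1), folded s_def]
    show ?thesis
    proof (intro conjI impI allI)
      show "bayes_mse M x obs i opt \<le> bayes_mse M x obs i h"
        using minimum(1) by (simp add: mse opt_mse)
      fix z assume "bayes_mse M x obs i h \<le> bayes_mse M x obs i opt"
      then have "w = s i"
        using minimum(2) by (simp add: mse opt_mse)
      then show "h z $ i = opt z $ i"
        using con(2) by (simp add: h_nth opt_nth c_def algebra_simps)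
    qed
  qed
  have "is_cwcu_lmmse M x obs g \<longleftrightarrow> g = opt"
  proof
    assume g: "is_cwcu_lmmse M x obs g"
    have "g z $ i = opt z $ i" for z i
      using g competitor[of g i] opt_affine opt_cwcu unfolding is_cwcu_lmmse_def by blast
    then show "g = opt"
      by (simp add: fun_eq_iff vec_eq_iff)
  next
    assume "g = opt"
    then show "is_cwcu_lmmse M x obs g"
      using opt_affine opt_cwcu competitor unfolding is_cwcu_lmmse_def by blast
  qed
  then show ?thesis
    by (simp add: opt_def [abs_def])
qed

theorem proposition3:
  fixes M :: "'a measure"
    and x :: "'a \<Rightarrow> complex^'n"
    and n y :: "'a \<Rightarrow> complex^'m"
    and H :: "complex^'n^'m"
    and Cxx :: "complex^'n^'n"
    and Cnn A :: "complex^'m^'m"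
    and D :: "complex^'n^'n"
    and E\<^sub>C\<^sub>L :: "complex^'m^'n"
    and \<sigma>2 :: "'n \<Rightarrow> real"
  assumes "prob_space M"
    and "x \<in> borel_measurable M"
    and "n \<in> borel_measurable M"
    and "\<And>i. integrable M (\<lambda>\<omega>. (cmod (x \<omega> $ i))\<^sup>2)"
    and "\<And>k. integrable M (\<lambda>\<omega>. (cmod (n \<omega> $ k))\<^sup>2)"
    and "prob_space.indep_vars M (\<lambda>_. borel) (\<lambda>i \<omega>. x \<omega> $ i) UNIV"
    and "indep_rv M x n"
    and "(\<integral>\<omega>. n \<omega> \<partial>M) = 0"
    and "y = (\<lambda>\<omega>. H *v x \<omega> + n \<omega>)"
    and "\<And>i. \<sigma>2 i = complex_variance M (\<lambda>\<omega>. x \<omega> $ i)"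
    and "Cxx = cross_cov M x x"
    and "Cxx = (\<chi> i j. if i = j then of_real (\<sigma>2 i) else 0)"
    and "Cnn = cross_cov M n n"
    and "A = H ** Cxx ** conj_transpose H + Cnn"
    and "invertible A"
    and "\<And>i. \<sigma>2 i > 0"
    and "\<And>i. column i H \<noteq> 0"
    and "D = (\<chi> i j. if i = j
                then 1 / (of_real (\<sigma>2 i) * hdot (column i H) (matrix_inv A *v column i H))
                else 0)"
    and "E\<^sub>C\<^sub>L = D ** Cxx ** conj_transpose H ** matrix_inv A"
  shows "(\<forall>i. hdot (column i H) (matrix_inv A *v column i H) \<noteq> 0 \<and> D $ i $ i \<in> \<real>) \<and>
         (\<forall>g. is_cwcu_lmmse M x y g \<longleftrightarrow>
            g = (\<lambda>z. (\<integral>\<omega>. x \<omega> \<partial>M) + E\<^sub>C\<^sub>L *v (z - (\<integral>\<omega>. y \<omega> \<partial>M))))"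
proof -
  interpret prob_space M by fact
  have x_nth: "square_integrable M (\<lambda>\<omega>. x \<omega> $ i)" for i
    unfolding square_integrable_def using assms(2,4) by (simp add: measurable_vec_nth)
  have n_nth: "square_integrable M (\<lambda>\<omega>. n \<omega> $ k)" for k
    unfolding square_integrable_def using assms(3,5) by (simp add: measurable_vec_nth)
  have x_mean: "(\<integral>\<omega>. x \<omega> \<partial>M) = (\<chi> i. \<integral>\<omega>. x \<omega> $ i \<partial>M)"
    by (rule integral_vec_nth[OF assms(2) square_integrable_integrable[OF x_nth]])
  have n_mean: "(\<integral>\<omega>. n \<omega> \<partial>M) = (\<chi> k. \<integral>\<omega>. n \<omega> $ k \<partial>M)"
    by (rule integral_vec_nth[OF assms(3) square_integrable_integrable[OF n_nth]])
  interpret linear_observation M x n H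
  proof unfold_locales
    show "indep_var borel (\<lambda>\<omega>. x \<omega> $ j) borel (\<lambda>\<omega>. x \<omega> $ i)" if "j \<noteq> i" for i j
      by (rule indep_vars_pair[OF assms(6) that])
    show "indep_var borel (\<lambda>\<omega>. n \<omega> $ k) borel (\<lambda>\<omega>. x \<omega> $ i)" for k i
      by (rule indep_rv_components[OF assms(7,2,3)])
    show "(\<integral>\<omega>. n \<omega> $ k \<partial>M) = 0" for k
      using assms(8) n_mean by (simp add: vec_eq_iff)
  qed (fact x_nth n_nth)+
  let ?h = "\<lambda>i. column i H"
  have y: "y = obs"
    unfolding assms(9) by (simp add: obs_def [abs_def])
  have x_mean_eq: "(\<integral>\<omega>. x \<omega> \<partial>M) = mean"
    by (simp add: x_mean mean_def)
  have y_mean: "(\<integral>\<omega>. y \<omega> \<partial>M) = H *v mean"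
  proof -
    have "obs \<in> borel_measurable M"
      unfolding obs_def [abs_def] using assms(2,3)
      by (intro borel_measurable_add measurable_compose[OF assms(2)] borel_measurable_continuous_onI
          linear_continuous_on matrix_vector_mul_bounded_linear)
    have int: "integrable M (\<lambda>\<omega>. centered_obs \<omega> $ k)" for k
      by (rule square_integrable_integrable[OF centered_obs_square_integrable])
    have "(\<integral>\<omega>. centered_obs \<omega> $ k \<partial>M) = 0" for k
      unfolding centered_obs_nth
      by (simp add: deviation_centered noise_centered square_integrable_integrable
          deviation_square_integrable noise_square_integrable)
    then show ?thesis
      using integral_vec_nth[OF \<open>obs \<in> borel_measurable M\<close>] int
      by (simp add: y obs_eq vec_eq_iff prob_space)
  qed
  have A: "A = obs_cov"
    unfolding assms(14,12,13) obs_cov_def cross_cov_def assms(8,10) cross_moment_def by simp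
  have inv: "invertible obs_cov"
    using assms(15) by (simp add: A)
  have pd: "positive_definite obs_cov"
    by (rule positive_definite_second_moments[OF centered_obs_square_integrable cross_moment_obs inv])
  have q: "hdot (?h i) (matrix_inv A *v ?h i) \<noteq> 0 \<and> hdot (?h i) (matrix_inv A *v ?h i) \<in> \<real>" for i
    by (rule positive_definite_inverse_form[OF pd inv assms(17)[of i]]) (simp add: A)
  have D: "D $ i $ i \<in> \<real>" for i
    using q[of i] by (simp add: assms(18))
  have E: "(E\<^sub>C\<^sub>L *v z) $ i = hdot (constrained_minimizer obs_cov (?h i)) z" for i z
  proof -
    let ?q = "hdot (?h i) (matrix_inv A *v ?h i)"
    have "E\<^sub>C\<^sub>L *v z = D *v (Cxx *v (conj_transpose H *v (matrix_inv A *v z)))"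
      by (simp only: assms(19) matrix_vector_mul_assoc matrix_mul_assoc)
    then have "(E\<^sub>C\<^sub>L *v z) $ i =
        1 / (of_real (\<sigma>2 i) * ?q) * (of_real (\<sigma>2 i) * hdot (?h i) (matrix_inv A *v z))"
      by (simp only: assms(12,18) diagonal_vector_nth conj_transpose_vector_nth)
    also have "\<dots> = 1 / ?q * hdot (?h i) (matrix_inv A *v z)"
      using assms(16)[of i] by simp
    also have "\<dots> = cnj (1 / ?q) * hdot (matrix_inv A *v ?h i) z"
      using q[of i] positive_definite_inverse_hermitian[OF pd inv, of "?h i" z]
      by (simp add: A Reals_cnj_iff)
    also have "\<dots> = hdot (constrained_minimizer obs_cov (?h i)) z"
      by (simp add: constrained_minimizer_def hdot_scale_left A)
    finally show ?thesis .
  qed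
  have var: "variance_of i > 0" for i
    using assms(16)[of i] by (simp add: assms(10))
  show ?thesis
    unfolding x_mean_eq y_mean
    unfolding y using q D cwcu_lmmse_iff[OF var pd inv assms(17) E] by blast
qed

end
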